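(* Let $n\ge5$, let $\mathbb F$ be an algebraically closed field of characteristic not $2$, and let $V$ be the $(2n-1)$-dimensional $\mathbb F$-space with basis $e_1,\dots,e_{n-1},f_1,\dots,f_{n-1},g$ and symmetric bilinear form $B$ given by $B(e_i,f_j)=\delta_{ij}$, $B(g,g)=2$, and $B(e_i,e_j)=B(f_i,f_j)=B(e_i,g)=B(f_i,g)=0$. Let $\gamma\in\mathbb F$ with $\gamma(\gamma+1)\ne0$. Put $$u_1=e_1-e_2,\quad v_1=f_1+f_2,\qquad u_i=e_{i-1}+e_i,\quad v_i=f_{i-1}-f_i\quad(1<i<n),$$ $$u_n=\gamma e_{n-2}+f_{n-2}+\gamma e_{n-1}-f_{n-1},\qquad v_n=e_{n-2}-f_{n-2}+(1-\gamma)e_{n-1}+g .$$ Then the transformations $T_{u_i,v_i}$, $1\le i\le n$, realize the graph $\Gamma_{B;n}$ with vertices $1,\dots,n$ and edges $\{i,i+1\}$ ($1\le i\le n-2$), $\{1,3\}$ and $\{n-2,n\}$. Moreover, the Lie algebra $\langle T_{u_i,v_i}\mid 1\le i\le n\rangle_{\mathrm{Lie}}$ they generate is $\mathfrak o_{2n-1}$, the Lie algebra of all endomorphisms of $V$ that are skew with respect to $B$.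
   Context: For $u,v\in V$, $T_{u,v}\colon V\to V$ is the linear map $x\mapsto B(u,x)v-B(v,x)u$. A nonzero element $x$ of a Lie algebra $\mathcal L$ over $\mathbb F$ is extremal if $[x,[x,\mathcal L]]\subseteq\mathbb Fx$. Elements $y_1,\dots,y_n$ of a Lie algebra realize a graph $\Gamma$ on $\{1,\dots,n\}$ if each $y_i$ is an extremal element of the Lie algebra generated by $y_1,\dots,y_n$ and, for $i\ne j$, vertices $i,j$ are adjacent if and only if $[y_i,y_j]\ne0$. The Lie bracket on endomorphisms is the commutator. *)

theory Defs
  imports
    "HOL-Library.Function_Algebras"
    "HOL-Computational_Algebra.Computational_Algebra"
begin

text \<open>The algebra is a subspace \<open>L\<close> of an ambient vector space, and the bracket is only required
  to behave well on \<open>L\<close>. The type of all functions \<open>'v \<Rightarrow> 'v\<close> can therefore serve as the ambient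
  space of the Lie algebra of endomorphisms.\<close>

locale lie_algebra = vector_space scale
  for scale :: "'f::field \<Rightarrow> 'l::ab_group_add \<Rightarrow> 'l" +
  fixes bracket :: "'l \<Rightarrow> 'l \<Rightarrow> 'l" and L :: "'l set"
  assumes subspace_carrier: "subspace L"
    and bracket_closed: "x \<in> L \<Longrightarrow> y \<in> L \<Longrightarrow> bracket x y \<in> L"
    and bracket_add_left: "x \<in> L \<Longrightarrow> y \<in> L \<Longrightarrow> z \<in> L \<Longrightarrow>
      bracket (x + y) z = bracket x z + bracket y z"
    and bracket_add_right: "x \<in> L \<Longrightarrow> y \<in> L \<Longrightarrow> z \<in> L \<Longrightarrow>
      bracket x (y + z) = bracket x y + bracket x z"
    and bracket_scale_left: "x \<in> L \<Longrightarrow> y \<in> L \<Longrightarrow>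
      bracket (scale c x) y = scale c (bracket x y)"
    and bracket_scale_right: "x \<in> L \<Longrightarrow> y \<in> L \<Longrightarrow>
      bracket x (scale c y) = scale c (bracket x y)"
    and bracket_self: "x \<in> L \<Longrightarrow> bracket x x = 0"
    and jacobi: "x \<in> L \<Longrightarrow> y \<in> L \<Longrightarrow> z \<in> L \<Longrightarrow>
      bracket x (bracket y z) + bracket y (bracket z x) + bracket z (bracket x y) = 0"

definition lie_subalgebra ::
  "('f::field \<Rightarrow> 'l::ab_group_add \<Rightarrow> 'l) \<Rightarrow> ('l \<Rightarrow> 'l \<Rightarrow> 'l) \<Rightarrow> 'l set \<Rightarrow> 'l set \<Rightarrow> bool"
  where "lie_subalgebra scale bracket L M \<longleftrightarrow>
    M \<subseteq> L \<and> module.subspace scale M \<and> (\<forall>x\<in>M. \<forall>y\<in>M. bracket x y \<in> M)"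

text \<open>Meaningful for \<open>S \<subseteq> L\<close> only: otherwise no subalgebra of \<open>L\<close> contains \<open>S\<close>, and the
  hull is \<open>UNIV\<close>.\<close>

definition lie_generated ::
  "('f::field \<Rightarrow> 'l::ab_group_add \<Rightarrow> 'l) \<Rightarrow> ('l \<Rightarrow> 'l \<Rightarrow> 'l) \<Rightarrow> 'l set \<Rightarrow> 'l set \<Rightarrow> 'l set"
  where "lie_generated scale bracket L S = lie_subalgebra scale bracket L hull S"

definition extremal ::
  "('f::field \<Rightarrow> 'l::ab_group_add \<Rightarrow> 'l) \<Rightarrow> ('l \<Rightarrow> 'l \<Rightarrow> 'l) \<Rightarrow> 'l set \<Rightarrow> 'l \<Rightarrow> bool"
  where "extremal scale bracket L x \<longleftrightarrow>
    x \<in> L \<and> x \<noteq> 0 \<and> (\<forall>y\<in>L. \<exists>c. bracket x (bracket x y) = scale c x)"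

text \<open>A graph on \<open>{1..n}\<close> is given by its set \<open>E\<close> of edges, which are two-element sets.\<close>

definition realizes_graph ::
  "('f::field \<Rightarrow> 'l::ab_group_add \<Rightarrow> 'l) \<Rightarrow> ('l \<Rightarrow> 'l \<Rightarrow> 'l) \<Rightarrow> 'l set \<Rightarrow>
    nat \<Rightarrow> (nat \<Rightarrow> 'l) \<Rightarrow> nat set set \<Rightarrow> bool"
  where "realizes_graph scale bracket L n y E \<longleftrightarrow>
    (\<forall>i\<in>{1..n}. extremal scale bracket (lie_generated scale bracket L (y ` {1..n})) (y i)) \<and>
    (\<forall>i\<in>{1..n}. \<forall>j\<in>{1..n}. i \<noteq> j \<longrightarrow> ({i, j} \<in> E \<longleftrightarrow> bracket (y i) (y j) \<noteq> 0))"

definition Gamma_B_edges :: "nat \<Rightarrow> nat set set"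
  where "Gamma_B_edges n = {{i, i + 1} | i. 1 \<le> i \<and> i + 2 \<le> n} \<union> {{1, 3}, {n - 2, n}}"

definition fun_scale :: "('f \<Rightarrow> 'v \<Rightarrow> 'v) \<Rightarrow> 'f \<Rightarrow> ('v \<Rightarrow> 'v) \<Rightarrow> 'v \<Rightarrow> 'v"
  where "fun_scale scale c h = (\<lambda>x. scale c (h x))"

definition commutator :: "('v \<Rightarrow> 'v) \<Rightarrow> ('v \<Rightarrow> 'v) \<Rightarrow> 'v \<Rightarrow> 'v::ab_group_add"
  where "commutator h k = (\<lambda>x. h (k x) - k (h x))"

definition endomorphisms :: "('f::field \<Rightarrow> 'v::ab_group_add \<Rightarrow> 'v) \<Rightarrow> ('v \<Rightarrow> 'v) set"
  where "endomorphisms scale = {h. Vector_Spaces.linear scale scale h}"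

lemma lie_algebra_endomorphisms:
  assumes "vector_space scale"
  shows "lie_algebra (fun_scale scale) commutator (endomorphisms scale)"
proof -
  interpret V: vector_space scale by fact
  interpret W: vector_space "fun_scale scale"
    by standard (simp_all add: fun_scale_def fun_eq_iff V.scale_right_distrib V.scale_left_distrib)
  have lin: "h \<in> endomorphisms scale \<longleftrightarrow>
      (\<forall>x y. h (x + y) = h x + h y) \<and> (\<forall>c x. h (scale c x) = scale c (h x))" for h
    by (simp add: endomorphisms_def Vector_Spaces.linear_iff V.vector_space_axioms)
  have diff: "h (x - y) = h x - h y" if "h \<in> endomorphisms scale" for h x y
    using that by (metis lin add_diff_cancel_right' diff_add_cancel)
  show ?thesis
    by unfold_locales
      (auto simp: W.subspace_def lin diff fun_scale_def commutator_def fun_eq_iff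
        V.scale_right_distrib V.scale_right_diff_distrib V.scale_left_commute algebra_simps)
qed

definition symmetric_bilinear_form ::
  "('f::field \<Rightarrow> 'v::ab_group_add \<Rightarrow> 'v) \<Rightarrow> ('v \<Rightarrow> 'v \<Rightarrow> 'f) \<Rightarrow> bool"
  where "symmetric_bilinear_form scale B \<longleftrightarrow>
    (\<forall>x. Vector_Spaces.linear scale (*) (B x)) \<and>
    (\<forall>y. Vector_Spaces.linear scale (*) (\<lambda>x. B x y)) \<and>
    (\<forall>x y. B x y = B y x)"

definition T_map ::
  "('f \<Rightarrow> 'v::ab_group_add \<Rightarrow> 'v) \<Rightarrow> ('v \<Rightarrow> 'v \<Rightarrow> 'f) \<Rightarrow> 'v \<Rightarrow> 'v \<Rightarrow> 'v \<Rightarrow> 'v"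
  where "T_map scale B u v = (\<lambda>x. scale (B u x) v - scale (B v x) u)"

definition skew_endomorphisms ::
  "('f::field \<Rightarrow> 'v::ab_group_add \<Rightarrow> 'v) \<Rightarrow> ('v \<Rightarrow> 'v \<Rightarrow> 'f) \<Rightarrow> ('v \<Rightarrow> 'v) set"
  where "skew_endomorphisms scale B =
    {h \<in> endomorphisms scale. \<forall>x y. B (h x) y = - B x (h y)}"

lemma T_map_in_endomorphisms:
  assumes "vector_space scale" and "symmetric_bilinear_form scale B"
  shows "T_map scale B u v \<in> endomorphisms scale"
proof -
  interpret V: vector_space scale by fact
  have "B w (x + y) = B w x + B w y" "B w (scale c x) = c * B w x" for w x y c
    using assms(2) by (auto simp: symmetric_bilinear_form_def Vector_Spaces.linear_iff)
  then show ?thesis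
    by (simp add: endomorphisms_def Vector_Spaces.linear_iff V.vector_space_axioms T_map_def
        V.scale_left_distrib V.scale_right_diff_distrib)
qed

end

theory Submission
  imports Defs
begin

text \<open>Every \<open>T u v\<close> is skew and \<open>[T u v, T x y] = T (T u v x) y + T x (T u v y)\<close>; adjacency is
  read off from this formula, and extremality from \<open>u\<close>, \<open>v\<close> spanning a totally isotropic space.

  For generation, the first two generators and their bracket give \<open>T e\<^sub>1 f\<^sub>2\<close> and \<open>T e\<^sub>2 f\<^sub>1\<close>, and
  each further generator of the path enlarges the set of available \<open>T e\<^sub>a f\<^sub>b\<close> (\<open>a \<noteq> b\<close>) by one
  index. Bracketing the last generator with \<open>T e\<^sub>a f\<^sub>b\<close> isolates its components and yields all
  \<open>T e\<^sub>a e\<^sub>b\<close>, \<open>T e\<^sub>a g\<close>, \<open>T f\<^sub>a f\<^sub>b\<close>, \<open>T f\<^sub>a g\<close>, and finally \<open>[T e\<^sub>a g, T f\<^sub>a g] = 2 T e\<^sub>a f\<^sub>a\<close>.\<close>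

section \<open>Skew maps and the bracket of maps \<open>T u v\<close> for a symmetric bilinear
  form\<close>

locale symmetric_bilinear_space = vector_space scale
  for scale :: "'f::field \<Rightarrow> 'v::ab_group_add \<Rightarrow> 'v" (infixr "*s" 75) +
  fixes B :: "'v \<Rightarrow> 'v \<Rightarrow> 'f"
  assumes form: "symmetric_bilinear_form scale B"
begin

abbreviation T where "T \<equiv> T_map scale B"

lemma B_sym: "B x y = B y x"
  using form by (auto simp: symmetric_bilinear_form_def)

lemma B_add_right [simp]: "B x (y + z) = B x y + B x z"
  and B_scale_right [simp]: "B x (c *s y) = c * B x y"
  using form by (auto simp: symmetric_bilinear_form_def Vector_Spaces.linear_iff)

lemma B_add_left [simp]: "B (x + y) z = B x z + B y z"
  and B_scale_left [simp]: "B (c *s x) z = c * B x z"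
  using B_add_right B_scale_right B_sym by metis+

lemma B_minus_right [simp]: "B x (- y) = - B x y"
  using B_scale_right[of x "-1" y] by simp

lemma B_minus_left [simp]: "B (- x) y = - B x y"
  using B_minus_right B_sym by metis

lemma B_diff_right [simp]: "B x (y - z) = B x y - B x z"
  using B_add_right[of x y "- z"] by simp

lemma B_diff_left [simp]: "B (x - y) z = B x z - B y z"
  using B_add_left[of x "- y" z] by simp

lemma B_zero_right [simp]: "B x 0 = 0"
  using B_scale_right[of x 0 0] by simp

lemma B_zero_left [simp]: "B 0 x = 0"
  using B_sym[of 0 x] by simp

lemma T_apply: "T x y z = B x z *s y - B y z *s x"
  by (simp add: T_map_def)

lemma T_add_left: "T (x + y) z = T x z + T y z"
  and T_add_right: "T z (x + y) = T z x + T z y"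
  and T_diff_left: "T (x - y) z = T x z - T y z"
  and T_diff_right: "T z (x - y) = T z x - T z y"
  and T_minus_left: "T (- x) z = - T x z"
  and T_minus_right: "T z (- x) = - T z x"
  and T_scale_left: "T (c *s x) z = fun_scale scale c (T x z)"
  and T_scale_right: "T z (c *s x) = fun_scale scale c (T z x)"
  by (auto simp: fun_eq_iff T_apply fun_scale_def scale_left_distrib scale_right_distrib
      scale_left_diff_distrib scale_right_diff_distrib mult.commute)

lemma T_self [simp]: "T x x = 0" and T_zero_left [simp]: "T 0 x = 0" and T_zero_right [simp]: "T x 0 = 0"
  by (auto simp: fun_eq_iff T_apply)

lemma T_swap: "T y x = - T x y"
  by (simp add: fun_eq_iff T_apply)

lemmas T_linear = T_add_left T_add_right T_diff_left T_diff_right T_minus_left T_minus_right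
  T_scale_left T_scale_right

lemma vector_space_fun: "vector_space (fun_scale scale)"
  by standard (simp_all add: fun_scale_def fun_eq_iff scale_right_distrib scale_left_distrib)

sublocale W: vector_space "fun_scale scale"
  by (rule vector_space_fun)

lemma endomorphisms_iff: "h \<in> endomorphisms scale \<longleftrightarrow>
    (\<forall>x y. h (x + y) = h x + h y) \<and> (\<forall>c x. h (c *s x) = c *s h x)"
  by (simp add: endomorphisms_def Vector_Spaces.linear_iff vector_space_axioms)

lemma skew_D:
  assumes "h \<in> skew_endomorphisms scale B"
  shows "h (x + y) = h x + h y" "h (c *s x) = c *s h x" "h (x - y) = h x - h y"
    "B (h x) y = - B x (h y)"
proof -
  show add: "h (x + y) = h x + h y" for x y
    using assms by (simp add: skew_endomorphisms_def endomorphisms_iff)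
  show "h (c *s x) = c *s h x" "B (h x) y = - B x (h y)"
    using assms by (auto simp: skew_endomorphisms_def endomorphisms_iff)
  show "h (x - y) = h x - h y"
    using add[of "x - y" y] by simp
qed

lemma T_skew: "T x y \<in> skew_endomorphisms scale B"
  using T_map_in_endomorphisms[OF vector_space_axioms form]
  by (auto simp: skew_endomorphisms_def T_apply B_sym algebra_simps)

text \<open>Under the correspondence of \<open>T x y\<close> with the wedge of \<open>x\<close> and
  \<open>y\<close>, a skew map acts as a derivation. Skewness moves \<open>h\<close> from the
  argument of the map onto \<open>x\<close> and \<open>y\<close> inside \<open>B\<close>.\<close>

lemma commutator_skew_T:
  assumes "h \<in> skew_endomorphisms scale B"
  shows "commutator h (T x y) = T (h x) y + T x (h y)"
  by (auto simp: fun_eq_iff commutator_def T_apply skew_D[OF assms] algebra_simps)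

lemma commutator_T_T: "commutator (T u v) (T x y) = T (T u v x) y + T x (T u v y)"
  by (rule commutator_skew_T[OF T_skew])

lemma lie_subalgebra_skew:
  "lie_subalgebra (fun_scale scale) commutator (endomorphisms scale) (skew_endomorphisms scale B)"
proof -
  interpret L: lie_algebra "fun_scale scale" commutator "endomorphisms scale"
    by (rule lie_algebra_endomorphisms[OF vector_space_axioms])
  have "W.subspace (skew_endomorphisms scale B)"
    unfolding W.subspace_def using L.subspace_carrier
    by (auto simp: skew_endomorphisms_def W.subspace_def fun_scale_def)
  moreover have "commutator h k \<in> skew_endomorphisms scale B"
    if "h \<in> skew_endomorphisms scale B" "k \<in> skew_endomorphisms scale B" for h k
    using that L.bracket_closed[of h k] unfolding skew_endomorphisms_def
    by (auto simp: commutator_def)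
  ultimately show ?thesis
    by (auto simp: lie_subalgebra_def skew_endomorphisms_def)
qed

text \<open>On a totally isotropic pair, \<open>T = T u v\<close> satisfies \<open>T T = 0\<close> and
  \<open>T h T = B u (h v) T\<close>; expanding the double commutator leaves \<open>- 2 T h T\<close>.\<close>

lemma double_commutator_T:
  assumes two: "(2::'f) \<noteq> 0" and h: "h \<in> skew_endomorphisms scale B"
    and iso: "B u u = 0" "B u v = 0" "B v v = 0"
  shows "commutator (T u v) (commutator (T u v) h) = fun_scale scale (- 2 * B u (h v)) (T u v)"
proof
  fix x
  \<comment> \<open>The value \<open>B w (h w)\<close> equals its own negative; this is where
    characteristic other than 2 enters extremality.\<close>
  have alt: "B w (h w) = 0" for w
  proof -
    have "B w (h w) = - B w (h w)"
      using skew_D(4)[OF h, of w w] B_sym by metis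
    then have "2 * B w (h w) = 0" by (simp add: eq_neg_iff_add_eq_0)
    then show ?thesis using two by simp
  qed
  have swap: "B v (h u) = - B u (h v)"
    using skew_D(4)[OF h, of u v] B_sym[of v "h u"] by simp
  have iso': "B v u = 0" using iso B_sym by metis
  have "commutator (T u v) (commutator (T u v) h) x
      = - (B u (h v) *s T u v x) - B u (h v) *s T u v x"
    by (simp add: commutator_def T_apply skew_D[OF h] iso iso' alt swap algebra_simps)
  also have "\<dots> = (- 2 * B u (h v)) *s T u v x"
    using scale_left_distrib[of "- B u (h v)" "- B u (h v)" "T u v x"] by simp
  finally show "commutator (T u v) (commutator (T u v) h) x = fun_scale scale (- 2 * B u (h v)) (T u v) x"
    by (simp only: fun_scale_def)
qed

lemma extremal_T:
  assumes two: "(2::'f) \<noteq> 0" and L: "T u v \<in> L" "L \<subseteq> skew_endomorphisms scale B"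
    and iso: "B u u = 0" "B u v = 0" "B v v = 0" and nz: "T u v \<noteq> 0"
  shows "extremal (fun_scale scale) commutator L (T u v)"
  unfolding extremal_def using L nz double_commutator_T[OF two _ iso] by blast

lemma T_nonzero: "B (T u v x) y \<noteq> 0 \<Longrightarrow> T u v \<noteq> 0"
  by auto

text \<open>A single nonzero matrix entry certifies adjacency. The bracket stands in expanded form,
  so that the entry can be computed from values of \<open>B\<close> on basis vectors.\<close>

lemma commutator_T_nonzero: "B ((T (T u v x) y + T x (T u v y)) z) w \<noteq> 0 \<Longrightarrow>
    commutator (T u v) (T x y) \<noteq> 0"
  unfolding commutator_T_T by (auto simp del: plus_fun_apply)

text \<open>\<open>T u v\<close> kills every vector orthogonal to \<open>u\<close> and
  \<open>v\<close>, so both terms of the bracket formula vanish.\<close>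

lemma commutator_T_zero:
  "B u x = 0 \<Longrightarrow> B v x = 0 \<Longrightarrow> B u y = 0 \<Longrightarrow> B v y = 0 \<Longrightarrow> commutator (T u v) (T x y) = 0"
  by (simp add: commutator_T_T T_apply)

lemma commutator_T_swap: "commutator (T u v) (T x y) = - commutator (T x y) (T u v)"
  by (simp add: fun_eq_iff commutator_def)

end

section \<open>Hyperbolic pairs \<open>e i\<close>, \<open>f i\<close> and one anisotropic vector
  \<open>g\<close>\<close>

locale split_odd_space = symmetric_bilinear_space scale B
  for scale :: "'f::field \<Rightarrow> 'v::ab_group_add \<Rightarrow> 'v" (infixr "*s" 75) and B +
  fixes e f :: "nat \<Rightarrow> 'v" and g :: 'v and I :: "nat set"
  assumes two: "(2::'f) \<noteq> 0"
    and finite_I: "finite I"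
    and span_basis: "span (e ` I \<union> f ` I \<union> {g}) = UNIV"
    and B_ef: "i \<in> I \<Longrightarrow> j \<in> I \<Longrightarrow> B (e i) (f j) = (if i = j then 1 else 0)"
    and B_gg [simp]: "B g g = 2"
    and B_ee [simp]: "i \<in> I \<Longrightarrow> j \<in> I \<Longrightarrow> B (e i) (e j) = 0"
    and B_ff [simp]: "i \<in> I \<Longrightarrow> j \<in> I \<Longrightarrow> B (f i) (f j) = 0"
    and B_eg [simp]: "i \<in> I \<Longrightarrow> B (e i) g = 0"
    and B_fg [simp]: "i \<in> I \<Longrightarrow> B (f i) g = 0"
begin

lemma four: "(4::'f) \<noteq> 0"
proof -
  have "(2::'f) * 2 \<noteq> 0" using two by (simp only: mult_eq_0_iff simp_thms)
  then show ?thesis by simp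
qed

lemma B_ef_simps [simp]:
  "i \<in> I \<Longrightarrow> B (e i) (f i) = 1" "i \<in> I \<Longrightarrow> B (f i) (e i) = 1"
  "i \<in> I \<Longrightarrow> j \<in> I \<Longrightarrow> i \<noteq> j \<Longrightarrow> B (e i) (f j) = 0"
  "i \<in> I \<Longrightarrow> j \<in> I \<Longrightarrow> i \<noteq> j \<Longrightarrow> B (f i) (e j) = 0"
  "i \<in> I \<Longrightarrow> B g (e i) = 0" "i \<in> I \<Longrightarrow> B g (f i) = 0"
  using B_ef B_eg B_fg B_sym by metis+

lemma basis_induct [consumes 0, case_names e f g add scale]:
  assumes "\<And>i. i \<in> I \<Longrightarrow> P (e i)" "\<And>i. i \<in> I \<Longrightarrow> P (f i)" "P g"
    and add: "\<And>x y. P x \<Longrightarrow> P y \<Longrightarrow> P (x + y)" and scale: "\<And>c x. P x \<Longrightarrow> P (c *s x)"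
  shows "P x"
proof -
  have "x \<in> span (e ` I \<union> f ` I \<union> {g})" by (simp only: span_basis UNIV_I)
  then show ?thesis
  proof (induction rule: span_induct_alt)
    case base
    show ?case using scale[OF \<open>P g\<close>, of 0] by simp
  next
    case (step c x y)
    then show ?case using assms by auto
  qed
qed

text \<open>The basis dual to \<open>e i\<close>, \<open>f i\<close>, \<open>g\<close> is
  \<open>f i\<close>, \<open>e i\<close>, \<open>g / 2\<close>. Doubling the expansion avoids the
  division, and linearity reduces it to basis vectors.\<close>

lemma expand:
  "2 *s x = 2 *s (\<Sum>i\<in>I. B (f i) x *s e i + B (e i) x *s f i) + B g x *s g" (is "_ = ?E x")
proof (induction x rule: basis_induct)
  case (e j)
  have "(\<Sum>i\<in>I. B (f i) (e j) *s e i + B (e i) (e j) *s f i) = (\<Sum>i\<in>I. if j = i then e j else 0)"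
    using e by (intro sum.cong) auto
  then show ?case using e by (simp add: finite_I)
next
  case (f j)
  have "(\<Sum>i\<in>I. B (f i) (f j) *s e i + B (e i) (f j) *s f i) = (\<Sum>i\<in>I. if j = i then f j else 0)"
    using f by (intro sum.cong) auto
  then show ?case using f by (simp add: finite_I)
next
  case g
  then show ?case by simp
next
  case (add x y)
  have "?E (x + y) = ?E x + ?E y"
    by (simp add: algebra_simps sum.distrib)
  then show ?case using add by (simp only: scale_right_distrib)
next
  case (scale c x)
  have "?E (c *s x) = c *s ?E x"
    by (simp add: scale_right_distrib scale_sum_right mult.left_commute)
  then show ?case using scale by (simp only: scale_left_commute)
qed

end

section \<open>Which \<open>T x y\<close> a Lie subalgebra \<open>M\<close> must contain\<close>

locale T_subalgebra = split_odd_space +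
  fixes M :: "('b \<Rightarrow> 'b) set"
  assumes lie_subalgebra: "lie_subalgebra (fun_scale scale) commutator (endomorphisms scale) M"
begin

lemma M_subspace: "W.subspace M"
  using lie_subalgebra by (simp add: lie_subalgebra_def)

lemmas M_add = W.subspace_add[OF M_subspace]
  and M_diff = W.subspace_diff[OF M_subspace]
  and M_neg = W.subspace_neg[OF M_subspace]
  and M_scale = W.subspace_scale[OF M_subspace]
  and M_zero = W.subspace_0[OF M_subspace]

lemma M_scale_iff: "c \<noteq> 0 \<Longrightarrow> fun_scale scale c h \<in> M \<longleftrightarrow> h \<in> M"
  using M_scale[of h c] M_scale[of "fun_scale scale c h" "inverse c"] by auto

lemma M_neg_iff: "- h \<in> M \<longleftrightarrow> h \<in> M"
  using M_neg[of h] M_neg[of "- h"] by auto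

text \<open>As rewrite rules these discard the summands already known to lie in \<open>M\<close>, so
  that an expanded bracket reduces to its one new term.\<close>

lemma M_cancel:
  "h \<in> M \<Longrightarrow> h + k \<in> M \<longleftrightarrow> k \<in> M" "h \<in> M \<Longrightarrow> k + h \<in> M \<longleftrightarrow> k \<in> M"
  "h \<in> M \<Longrightarrow> h - k \<in> M \<longleftrightarrow> k \<in> M" "h \<in> M \<Longrightarrow> k - h \<in> M \<longleftrightarrow> k \<in> M"
proof -
  assume h: "h \<in> M"
  show 1: "h + k \<in> M \<longleftrightarrow> k \<in> M" for k
    using h M_add[of h k] M_diff[of "h + k" h] by auto
  show "k + h \<in> M \<longleftrightarrow> k \<in> M"
    using 1[of k] by (simp only: add.commute)
  show "h - k \<in> M \<longleftrightarrow> k \<in> M"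
    using 1[of "- k"] M_neg_iff[of k] by simp
  show "k - h \<in> M \<longleftrightarrow> k \<in> M"
    using 1[of "k - h"] by simp
qed

lemma T_swap_mem: "T y x \<in> M \<longleftrightarrow> T x y \<in> M"
  by (metis T_swap M_neg_iff)

lemma M_bracket: "T u v \<in> M \<Longrightarrow> T x y \<in> M \<Longrightarrow> T (T u v x) y + T x (T u v y) \<in> M"
  using lie_subalgebra by (simp add: lie_subalgebra_def flip: commutator_T_T)

lemma T_mem_UNIV:
  assumes "\<And>i. i \<in> I \<Longrightarrow> T x (e i) \<in> M" "\<And>i. i \<in> I \<Longrightarrow> T x (f i) \<in> M" "T x g \<in> M"
  shows "T x y \<in> M"
  by (induction y rule: basis_induct) (use assms M_add M_scale in \<open>simp_all only: T_linear\<close>)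

text \<open>For dual bases \<open>b\<close>, \<open>b*\<close> of \<open>V\<close> and skew \<open>h\<close>, the sum of all \<open>T b* (h b)\<close> is \<open>2 h\<close>.\<close>

lemma skew_subset:
  assumes all: "\<And>x y. T x y \<in> M"
  shows "skew_endomorphisms scale B \<subseteq> M"
proof
  fix h assume h: "h \<in> skew_endomorphisms scale B"
  let ?S = "\<Sum>i\<in>I. T (f i) (h (e i)) + T (e i) (h (f i))"
  have hsum: "h (sum k A) = (\<Sum>i\<in>A. h (k i))" for k and A :: "'c set"
    using skew_D(2)[OF h, of 0 0]
    by (induction A rule: infinite_finite_induct) (auto simp: skew_D[OF h])
  \<comment> \<open>This is twice the dual basis identity: the vector dual to \<open>g\<close> is
    \<open>g / 2\<close>, hence coefficient 1 on \<open>T g (h g)\<close> and 4 on the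
    right.\<close>
  have "fun_scale scale 2 ?S + T g (h g) = fun_scale scale 4 h"
  proof
    fix x
    have sum_app: "sum k A x = (\<Sum>i\<in>A. k i x)" for k :: "'c \<Rightarrow> 'b \<Rightarrow> 'b" and A
      by (induction A rule: infinite_finite_induct) auto
    let ?E = "\<lambda>x. \<Sum>i\<in>I. B (f i) x *s e i + B (e i) x *s f i"
    have "?S x = (\<Sum>i\<in>I. h (B (f i) x *s e i + B (e i) x *s f i)
        + (B (f i) (h x) *s e i + B (e i) (h x) *s f i))"
      unfolding sum_app by (intro sum.cong) (auto simp: T_apply skew_D[OF h])
    also have "\<dots> = h (?E x) + ?E (h x)"
      by (subst sum.distrib) (simp only: hsum)
    finally have "(fun_scale scale 2 ?S + T g (h g)) x =
        h (2 *s ?E x + B g x *s g) + (2 *s ?E (h x) + B g (h x) *s g)"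
      by (simp add: fun_scale_def T_apply skew_D[OF h] scale_right_distrib del: sum.distrib)
    also have "\<dots> = h (2 *s x) + 2 *s h x"
      by (simp only: expand[symmetric])
    also have "\<dots> = (2 + 2) *s h x"
      by (simp only: skew_D[OF h] scale_left_distrib)
    finally show "(fun_scale scale 2 ?S + T g (h g)) x = fun_scale scale 4 h x"
      by (simp add: fun_scale_def)
  qed
  moreover have "fun_scale scale 2 ?S + T g (h g) \<in> M"
    by (intro M_add M_scale W.subspace_sum[OF M_subspace] all)
  ultimately show "h \<in> M"
    by (metis M_scale_iff four)
qed

text \<open>Induction along the path: the indices up to \<open>k\<close> are available after the
  generators 1 to \<open>k\<close>, and generator \<open>k + 1\<close> links index \<open>k\<close>
  to index \<open>k + 1\<close>.\<close>

lemma sl_mem: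
  assumes I: "I = {1..<n}" and n: "n \<ge> 3"
    and M1: "T (e 1 - e 2) (f 1 + f 2) \<in> M"
    and Mi: "\<And>i. 1 < i \<Longrightarrow> i < n \<Longrightarrow> T (e (i - 1) + e i) (f (i - 1) - f i) \<in> M"
    and ab: "a \<in> I" "b \<in> I" "a \<noteq> b"
  shows "T (e a) (f b) \<in> M"
proof -
  have "\<forall>a b. a \<in> {1..k} \<longrightarrow> b \<in> {1..k} \<longrightarrow> a \<noteq> b \<longrightarrow> T (e a) (f b) \<in> M"
    if "2 \<le> k" "k < n" for k
    using that
  proof (induction k rule: dec_induct)
    case base
    let ?e1 = "e 1" and ?e2 = "e 2" and ?f1 = "f 1" and ?f2 = "f 2"
    have I12: "1 \<in> I" "2 \<in> I" using I n by auto
    have M2: "T (?e1 + ?e2) (?f1 - ?f2) \<in> M" using Mi[of 2] n by simp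
    have half: "h \<in> M" if "h + h \<in> M" for h
    proof -
      have "h + h = fun_scale scale 2 h"
        using W.scale_left_distrib[of 1 1 h] by simp
      then show ?thesis using that two M_scale_iff by metis
    qed
    have two_scale: "2 *s z = z + z" for z
      using scale_left_distrib[of 1 1 z] by simp
    \<comment> \<open>Both generators have the same diagonal part
      \<open>T ?e1 ?f1 - T ?e2 ?f2\<close>, so it cancels in the difference.\<close>
    have "T (?e1 - ?e2) (?f1 + ?f2) - T (?e1 + ?e2) (?f1 - ?f2)
        = (T ?e1 ?f2 - T ?e2 ?f1) + (T ?e1 ?f2 - T ?e2 ?f1)"
      by (simp add: T_linear algebra_simps)
    then have d: "T ?e1 ?f2 - T ?e2 ?f1 \<in> M"
      using M_diff[OF M1 M2] half by metis
    have "T (?e1 - ?e2) (?f1 + ?f2) (?e1 + ?e2) = - ((?e1 - ?e2) + (?e1 - ?e2))"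
      "T (?e1 - ?e2) (?f1 + ?f2) (?f1 - ?f2) = (?f1 + ?f2) + (?f1 + ?f2)"
      using I12 by (simp_all add: T_apply two_scale del: One_nat_def)
    from M_bracket[OF M1 M2, unfolded this]
    \<comment> \<open>The diagonal terms cancel in the bracket too, which leaves the complementary
      combination four times.\<close>
    have "((T ?e1 ?f2 + T ?e2 ?f1) + (T ?e1 ?f2 + T ?e2 ?f1))
        + ((T ?e1 ?f2 + T ?e2 ?f1) + (T ?e1 ?f2 + T ?e2 ?f1)) \<in> M"
      by (simp add: T_linear algebra_simps)
    then have p: "T ?e1 ?f2 + T ?e2 ?f1 \<in> M" using half by blast
    have "T ?e1 ?f2 + T ?e1 ?f2 \<in> M" "T ?e2 ?f1 + T ?e2 ?f1 \<in> M"
      using M_add[OF p d] M_diff[OF p d] by (simp_all add: algebra_simps)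
    then have "T ?e1 ?f2 \<in> M" "T ?e2 ?f1 \<in> M" using half by blast+
    then show ?case
      by (auto simp: atLeastAtMost_iff numeral_2_eq_2 le_Suc_eq)
  next
    case (step k)
    let ?l = "Suc k"
    have kl: "k \<in> I" "?l \<in> I" using step I by auto
    have Mk: "T (e k + e ?l) (f k - f ?l) \<in> M" using Mi[of ?l] step by simp
    have IH: "T (e a) (f b) \<in> M" if "a \<in> {1..k}" "b \<in> {1..k}" "a \<noteq> b" for a b
      using step.IH step.prems that by simp
    \<comment> \<open>\<open>T (e a) (f k)\<close> sends \<open>e k\<close> to \<open>- e a\<close>
      and kills \<open>e ?l\<close>, \<open>f k\<close> and \<open>f ?l\<close>; its bracket with
      the generator is \<open>T (e a) (f ?l) - T (e a) (f k)\<close>.\<close>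
    have r: "T (e a) (f ?l) \<in> M" if a: "a \<in> {1..<k}" for a
    proof -
      have aI: "a \<in> I" "a \<noteq> k" "a \<noteq> ?l" using a step I by auto
      have ak: "T (e a) (f k) \<in> M" using IH a by simp
      from M_bracket[OF ak Mk] show ?thesis
        using aI kl ak by (simp add: T_apply T_linear M_neg_iff M_cancel)
    qed
    have l: "T (e ?l) (f a) \<in> M" if a: "a \<in> {1..<k}" for a
    proof -
      have aI: "a \<in> I" "a \<noteq> k" "a \<noteq> ?l" using a step I by auto
      have ak: "T (e k) (f a) \<in> M" using IH a by simp
      from M_bracket[OF ak Mk] show ?thesis
        using aI kl ak by (simp add: T_apply T_linear M_neg_iff M_cancel)
    qed
    \<comment> \<open>The two pairs formed by \<open>k\<close> and \<open>?l\<close> remain. They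
      are reached through the third index 1, which differs from \<open>k\<close> because the
      induction starts at 2.\<close>
    have one: "1 \<in> {1..<k}" "1 \<in> I" "1 \<noteq> k" "1 \<noteq> ?l" using step I by auto
    have "T (e k) (f 1) \<in> M" "T (e 1) (f k) \<in> M" using IH one by auto
    note r1 = M_bracket[OF this(1) r[OF one(1)]] and l1 = M_bracket[OF this(2) l[OF one(1)]]
    have kl': "T (e k) (f ?l) \<in> M"
      using r1 one kl by (simp add: T_apply T_linear M_neg_iff del: One_nat_def)
    have lk': "T (e ?l) (f k) \<in> M"
      using l1 one kl by (simp add: T_apply T_linear M_neg_iff del: One_nat_def)
    have "T (e a) (f b) \<in> M" if ab: "a \<in> {1..?l}" "b \<in> {1..?l}" "a \<noteq> b" for a b
    proof -
      consider "a \<le> k" "b \<le> k" | "a = ?l" "b < k" | "a = ?l" "b = k" | "a < k" "b = ?l" | "a = k" "b = ?l"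
        using ab by fastforce
      then show ?thesis
        using ab by cases (auto intro: IH r l kl' lk')
    qed
    then show ?case by blast
  qed
  from this[of "n - 1"] show ?thesis using ab n I by auto
qed

text \<open>\<open>T (e b) (f q)\<close> sends \<open>e q\<close> to \<open>- e b\<close> and kills
  \<open>e a\<close> and \<open>g\<close>, so its bracket with the mixed element isolates
  \<open>T (e a) (e b)\<close>. Maps \<open>T (e c) (f d)\<close> move indices and spread this to
  all pairs; subtracting the \<open>e q\<close> part then frees \<open>T (e a) g\<close>.\<close>

lemma isotropic_half:
  assumes sl: "\<And>c d. c \<in> I \<Longrightarrow> d \<in> I \<Longrightarrow> c \<noteq> d \<Longrightarrow> T (e c) (f d) \<in> M"
    and I: "a \<in> I" "b \<in> I" "q \<in> I" and neq: "a \<noteq> b" "a \<noteq> q" "b \<noteq> q"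
    and w: "T (e a) (s *s e q + t *s g) \<in> M" and s: "s \<noteq> 0" and t: "t \<noteq> 0"
  shows "c \<in> I \<Longrightarrow> d \<in> I \<Longrightarrow> T (e c) (e d) \<in> M" and "c \<in> I \<Longrightarrow> T (e c) g \<in> M"
proof -
  have ab: "T (e a) (e b) \<in> M"
    using M_bracket[OF sl[OF I(2,3) neq(3)] w] I neq s
    by (simp add: T_apply T_linear M_neg_iff M_scale_iff)
  have cb: "T (e c) (e b) \<in> M" if c: "c \<in> I" for c
  proof (cases "c = a")
    case False
    show ?thesis
      using M_bracket[OF sl[OF c I(1) False] ab] I neq c
      by (simp add: T_apply T_linear M_neg_iff)
  qed (use ab in simp)
  show ee: "T (e c) (e d) \<in> M" if c: "c \<in> I" and d: "d \<in> I" for c d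
  proof (cases "c = b \<or> d = b")
    case True
    then show ?thesis using cb c d T_swap_mem by blast
  next
    case False
    then show ?thesis
      using M_bracket[OF sl[OF d I(2)] cb[OF c]] I c d
      by (simp add: T_apply T_linear M_neg_iff)
  qed
  have ag: "T (e a) g \<in> M"
    using w t ee[OF I(1,3)] by (simp add: T_linear M_cancel M_scale M_scale_iff)
  show "T (e c) g \<in> M" if c: "c \<in> I" for c
  proof (cases "c = a")
    case False
    show ?thesis
      using M_bracket[OF sl[OF c I(1) False] ag] I neq c
      by (simp add: T_apply T_linear M_neg_iff)
  qed (use ag in simp)
qed

text \<open>The assumptions are symmetric in \<open>e\<close> and \<open>f\<close>, so
  \<open>isotropic_half\<close> also serves for \<open>T (f c) (f d)\<close> and
  \<open>T (f c) g\<close>.\<close>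

lemma swap_split: "T_subalgebra scale B f e g I M"
proof unfold_locales
  show "span (f ` I \<union> e ` I \<union> {g}) = UNIV"
    using span_basis by (simp only: Un_commute[of "f ` I"])
qed (use two finite_I lie_subalgebra in auto)

text \<open>The hypothesis \<open>xy\<close> is the last generator, with \<open>p\<close> and
  \<open>q\<close> the last two indices; \<open>a\<close> and \<open>b\<close> are auxiliary indices
  that do not occur in it.\<close>

lemma T_mem:
  assumes sl: "\<And>c d. c \<in> I \<Longrightarrow> d \<in> I \<Longrightarrow> c \<noteq> d \<Longrightarrow> T (e c) (f d) \<in> M"
    and I: "a \<in> I" "b \<in> I" "p \<in> I" "q \<in> I" and neq: "distinct [a, b, p, q]"
    and xy: "T (\<gamma> *s e p + f p + \<gamma> *s e q - f q) (e p - f p + (1 - \<gamma>) *s e q + g) \<in> M"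
    and \<gamma>: "\<gamma> \<noteq> 0"
  shows "T z w \<in> M"
proof -
  define x y where "x = \<gamma> *s e p + f p + \<gamma> *s e q - f q"
    and "y = e p - f p + (1 - \<gamma>) *s e q + g"
  note xy = xy[folded x_def y_def]
  have neq': "a \<noteq> b" "a \<noteq> p" "a \<noteq> q" "b \<noteq> p" "b \<noteq> q" "p \<noteq> q" using neq by auto
  note neq'' = neq' neq'[symmetric]
  have B: "B (e a) x = 0" "B (f a) x = 0" "B (e p) x = 1" "B (f p) x = \<gamma>"
    "B (e a) y = 0" "B (f a) y = 0" "B (e p) y = - 1" "B (f p) y = 1"
    using I neq'' by (simp_all add: x_def y_def)
  \<comment> \<open>\<open>T (e a) (f p)\<close> sends \<open>x\<close> to
    \<open>- \<gamma> *s e a\<close> and \<open>y\<close> to \<open>- e a\<close>. In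
    \<open>x - \<gamma> *s y\<close> the \<open>e p\<close> parts cancel, and the \<open>f\<close>
    parts are covered by \<open>sl\<close>.\<close>
  have "T (e a) (x - \<gamma> *s y) \<in> M"
    using M_bracket[OF sl[OF I(1,3) neq'(2)] xy]
    by (simp add: T_apply B T_linear T_swap[of "e a" x] minus_diff_commute)
  moreover have "x - \<gamma> *s y = (1 + \<gamma>) *s f p - f q + \<gamma> *s (\<gamma> *s e q + (- 1) *s g)"
    by (simp add: x_def y_def algebra_simps)
  ultimately have "T (e a) (\<gamma> *s e q + (- 1) *s g) \<in> M"
    using sl I neq'' \<gamma>
    by (simp add: T_add_right[of _ "_ - _"] T_diff_right[of _ "_ *s _" "f _"] T_scale_right
        M_cancel M_diff M_scale M_scale_iff del: scale_minus_left)
  note E = isotropic_half[OF sl I(1,2,4) neq'(1,3,5) this \<gamma>]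
  \<comment> \<open>Dually, \<open>T (e p) (f a)\<close> sends \<open>x\<close> to
    \<open>f a\<close> and \<open>y\<close> to \<open>- f a\<close>; now the \<open>f p\<close>
    parts cancel and \<open>sl\<close> covers the \<open>e\<close> parts.\<close>
  have "T (f a) (x + y) \<in> M"
    using M_bracket[OF sl[OF I(3,1) neq'(2)[symmetric]] xy]
    by (simp add: T_apply B T_linear T_swap[of "f a" x] minus_diff_commute)
  moreover have "x + y = (1 + \<gamma>) *s e p + e q + ((- 1) *s f q + 1 *s g)"
    by (simp add: x_def y_def algebra_simps)
  moreover have sl': "T (f c) (e d) \<in> M" if "c \<in> I" "d \<in> I" "c \<noteq> d" for c d
    using sl[of d c] that T_swap_mem by blast
  ultimately have "T (f a) ((- 1) *s f q + 1 *s g) \<in> M"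
    using I neq''
    by (simp add: T_add_right[of _ "_ *s e _ + e _"] T_add_right[of _ "_ *s e _" "e _"] T_scale_right
        M_cancel M_add M_scale M_scale_iff del: scale_minus_left scale_one)
  note F = T_subalgebra.isotropic_half[OF swap_split sl' I(1,2,4) neq'(1,3,5) this]
  have ef: "T (e c) (f d) \<in> M" if cd: "c \<in> I" "d \<in> I" for c d
  proof (cases "c = d")
    case True
    have "T (e c) g \<in> M" "T (f c) g \<in> M" using E F cd by auto
    \<comment> \<open>\<open>T (e c) g\<close> sends \<open>f c\<close> to \<open>g\<close> and
      \<open>g\<close> to \<open>- 2 *s e c\<close>, so the bracket is \<open>T g g\<close> minus
      twice \<open>T (f c) (e c)\<close>.\<close>
    from M_bracket[OF this] have "T (f c) (e c) \<in> M"
      using cd two by (simp add: T_apply T_linear M_neg_iff M_scale_iff)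
    then show ?thesis
      using T_swap_mem[of "f c" "e c"] True by simp
  qed (use sl cd in auto)
  have swapped: "T g (e c) \<in> M" "T g (f c) \<in> M" "d \<in> I \<Longrightarrow> T (f c) (e d) \<in> M" if "c \<in> I" for c d
    using E(2)[of c] F(2)[of c] ef[of d c] that
      T_swap_mem[of g "e c"] T_swap_mem[of g "f c"] T_swap_mem[of "f c" "e d"] by simp_all
  have g: "T g z \<in> M" for z
    by (rule T_mem_UNIV) (use swapped M_zero in auto)
  have e: "T (e c) z \<in> M" if "c \<in> I" for c z
    by (rule T_mem_UNIV) (use E ef that in auto)
  have f: "T (f c) z \<in> M" if "c \<in> I" for c z
    by (rule T_mem_UNIV) (use F swapped that in auto)
  show ?thesis
    by (rule T_mem_UNIV; subst T_swap_mem) (fact e f g)+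
qed

end

section \<open>The graph and the given generators\<close>

lemma Gamma_B_edges_iff:
  assumes "n \<ge> 5" "1 \<le> i" "i < j" "j \<le> n"
  shows "{i, j} \<in> Gamma_B_edges n \<longleftrightarrow>
    j = i + 1 \<and> j < n \<or> i = 1 \<and> j = 3 \<or> i = n - 2 \<and> j = n"
  using assms by (auto simp: Gamma_B_edges_def doubleton_eq_iff)

theorem theorem6p19:
  fixes scale :: "'f::alg_closed_field \<Rightarrow> 'v::ab_group_add \<Rightarrow> 'v"
    and n :: nat
    and e f :: "nat \<Rightarrow> 'v" and g :: 'v
    and B :: "'v \<Rightarrow> 'v \<Rightarrow> 'f"
    and \<gamma> :: 'f
    and u v :: "nat \<Rightarrow> 'v"
  assumes n: "n \<ge> 5"
    and char: "CHAR('f) \<noteq> 2"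
    and basis: "finite_dimensional_vector_space scale (e ` {1..<n} \<union> f ` {1..<n} \<union> {g})"
    and card_basis: "card (e ` {1..<n} \<union> f ` {1..<n} \<union> {g}) = 2 * n - 1"
    and form: "symmetric_bilinear_form scale B"
    and B_ef: "\<And>i j. i \<in> {1..<n} \<Longrightarrow> j \<in> {1..<n} \<Longrightarrow> B (e i) (f j) = (if i = j then 1 else 0)"
    and B_gg: "B g g = 2"
    and B_ee: "\<And>i j. i \<in> {1..<n} \<Longrightarrow> j \<in> {1..<n} \<Longrightarrow> B (e i) (e j) = 0"
    and B_ff: "\<And>i j. i \<in> {1..<n} \<Longrightarrow> j \<in> {1..<n} \<Longrightarrow> B (f i) (f j) = 0"
    and B_eg: "\<And>i. i \<in> {1..<n} \<Longrightarrow> B (e i) g = 0"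
    and B_fg: "\<And>i. i \<in> {1..<n} \<Longrightarrow> B (f i) g = 0"
    and gamma: "\<gamma> * (\<gamma> + 1) \<noteq> 0"
    and u_1: "u 1 = e 1 - e 2"
    and v_1: "v 1 = f 1 + f 2"
    and u_i: "\<And>i. 1 < i \<Longrightarrow> i < n \<Longrightarrow> u i = e (i - 1) + e i"
    and v_i: "\<And>i. 1 < i \<Longrightarrow> i < n \<Longrightarrow> v i = f (i - 1) - f i"
    and u_n: "u n = scale \<gamma> (e (n - 2)) + f (n - 2) + scale \<gamma> (e (n - 1)) - f (n - 1)"
    and v_n: "v n = e (n - 2) - f (n - 2) + scale (1 - \<gamma>) (e (n - 1)) + g"
  shows "realizes_graph (fun_scale scale) commutator (endomorphisms scale)
           n (\<lambda>i. T_map scale B (u i) (v i)) (Gamma_B_edges n)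
       \<and> lie_generated (fun_scale scale) commutator (endomorphisms scale)
           ((\<lambda>i. T_map scale B (u i) (v i)) ` {1..n}) = skew_endomorphisms scale B"
proof -
  interpret fd: finite_dimensional_vector_space scale "e ` {1..<n} \<union> f ` {1..<n} \<union> {g}"
    by (fact basis)
  have two: "(2::'f) \<noteq> 0"
  proof
    assume "(2::'f) = 0"
    then have "CHAR('f) dvd 2"
      using of_nat_eq_0_iff_char_dvd[of 2, where 'a = 'f] by simp
    then have "CHAR('f) = 1 \<or> CHAR('f) = 2"
      using two_is_prime_nat by (metis prime_nat_iff)
    then show False
      using char CHAR_not_1'[where 'a = 'f] by simp
  qed
  interpret split_odd_space scale B e f g "{1..<n}"
    by unfold_locales (use form two fd.span_Basis B_ef B_gg B_ee B_ff B_eg B_fg in auto)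
  let ?T = "\<lambda>i. T (u i) (v i)"
  let ?L = "lie_generated (fun_scale scale) commutator (endomorphisms scale) (?T ` {1..n})"

  have \<gamma>: "\<gamma> \<noteq> 0" using gamma by auto
  \<comment> \<open>Writing \<open>n\<close> as \<open>Suc (Suc p)\<close> removes subtraction from
    the indices, which makes them comparable.\<close>
  define p where "p = n - 2"
  have p: "n = Suc (Suc p)" "p \<ge> 3" using n by (auto simp: p_def)
  have u_n': "u (Suc (Suc p)) = scale \<gamma> (e p) + f p + scale \<gamma> (e (Suc p)) - f (Suc p)"
    and v_n': "v (Suc (Suc p)) = e p - f p + scale (1 - \<gamma>) (e (Suc p)) + g"
    using u_n v_n by (simp_all add: p)
  have u_Suc: "u (Suc k) = e k + e (Suc k)" and v_Suc: "v (Suc k) = f k - f (Suc k)"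
    if "1 \<le> k" "k \<le> p" for k
    using that u_i[of "Suc k"] v_i[of "Suc k"] by (simp_all add: p)
  have uv_23: "u 2 = e (Suc 0) + e 2" "v 2 = f (Suc 0) - f 2" "u 3 = e 2 + e 3" "v 3 = f 2 - f 3"
    using u_i[of 2] v_i[of 2] u_i[of 3] v_i[of 3] n by simp_all
  note u_1 = u_1[unfolded One_nat_def] and v_1 = v_1[unfolded One_nat_def]

  \<comment> \<open>Isotropy and nonvanishing of the generators\<close>
  have index_cases: "i = 1 \<or> (\<exists>k. i = Suc k \<and> 1 \<le> k \<and> k \<le> p) \<or> i = n" if "i \<in> {1..n}" for i
    using that p by (cases i) auto

  \<comment> \<open>For \<open>v n\<close>, the contribution -2 of \<open>e p - f p\<close> cancels
    \<open>B g g = 2\<close>.\<close>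
  have iso: "B (u i) (u i) = 0 \<and> B (u i) (v i) = 0 \<and> B (v i) (v i) = 0" if "i \<in> {1..n}" for i
    using index_cases[OF that] p
    by (auto simp: u_1 v_1 u_n' v_n' u_Suc v_Suc algebra_simps)

  have nonzero: "?T i \<noteq> 0" if i: "i \<in> {1..n}" for i
  proof -
    \<comment> \<open>The test vectors below give the matrix entries 1, 1 and -2.\<close>
    consider "i = 1" | k where "i = Suc k" "1 \<le> k" "k \<le> p" | "i = n"
      using index_cases[OF i] by blast
    then show ?thesis
    proof cases
      case 1
      then show ?thesis using p
        by (intro T_nonzero[of _ _ "f 1" "e 1"]) (simp add: T_apply u_1 v_1)
    next
      case 2
      then show ?thesis using p
        by (intro T_nonzero[of _ _ "f k" "e k"]) (simp add: T_apply u_Suc v_Suc)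
    next
      case 3
      then show ?thesis using p two
        by (intro T_nonzero[of _ _ g "e p"]) (simp add: T_apply u_n' v_n')
    qed
  qed

  \<comment> \<open>Adjacency, by the relative position of the two vertices\<close>
  have adjacent: "{i, j} \<in> Gamma_B_edges n \<longleftrightarrow> commutator (?T i) (?T j) \<noteq> 0"
    if ij: "1 \<le> i" "i < j" "j \<le> n" for i j
  proof -
    consider (12) "i = 1" "j = 2" | (13) "i = 1" "j = 3"
      | (path) k where "i = Suc k" "j = Suc (Suc k)" "1 \<le> k" "k < p"
      | (branch) k where "i = Suc k" "j = n" "p = Suc k"
      | (last) "i = Suc p" "j = n"
      | (far1) k where "i = 1" "j = Suc k" "3 \<le> k" "k \<le> p"
      | (far) k l where "i = Suc k" "j = Suc l" "1 \<le> k" "Suc k < l" "l \<le> p"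
      | (far1n) "i = 1" "j = n"
      | (farn) k where "i = Suc k" "j = n" "1 \<le> k" "Suc k < p"
    proof -
      obtain k l where kl: "i = Suc k" "j = Suc l" using ij by (cases i; cases j) auto
      have "k < l" "l \<le> Suc p" using ij kl p by auto
      then have "k = 0 \<and> l = 1 \<or> k = 0 \<and> l = 2 \<or> k = 0 \<and> 3 \<le> l \<and> l \<le> p \<or> k = 0 \<and> l = Suc p
          \<or> k \<ge> 1 \<and> l = Suc k \<and> k < p \<or> k = p \<and> l = Suc p \<or> k \<ge> 1 \<and> Suc k < l \<and> l \<le> p
          \<or> l = Suc p \<and> p = Suc k \<or> l = Suc p \<and> Suc k < p \<and> 1 \<le> k"
        by presburger
      then show ?thesis
        using kl p by (elim disjE conjE) (rule that; simp)+
    qed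
    note cases = this
    have edge: "{i, j} \<in> Gamma_B_edges n \<longleftrightarrow> j = i + 1 \<and> j < n \<or> i = 1 \<and> j = 3 \<or> i = n - 2 \<and> j = n"
      by (rule Gamma_B_edges_iff[OF n ij])
    from cases show ?thesis
    proof cases
      case 12
      \<comment> \<open>In the adjacent cases the test vectors give the entries -4, 1, -1 and 2, in
        this order.\<close>
      have "commutator (?T 1) (?T 2) \<noteq> 0"
        using p four
        by (intro commutator_T_nonzero[of _ _ _ _ "e 1" "f 2"]) (simp add: T_apply u_1 v_1 uv_23)
      moreover have "{i, j} \<in> Gamma_B_edges n"
        unfolding edge using 12 p by simp
      ultimately show ?thesis using 12 by simp
    next
      case 13
      have "commutator (?T 1) (?T 3) \<noteq> 0"
        using p
        by (intro commutator_T_nonzero[of _ _ _ _ "f 1" "e 3"]) (simp add: T_apply u_1 v_1 uv_23)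
      moreover have "{i, j} \<in> Gamma_B_edges n"
        unfolding edge using 13 p by simp
      ultimately show ?thesis using 13 by simp
    next
      case path
      have "commutator (?T i) (?T j) \<noteq> 0"
        using path p
        by (intro commutator_T_nonzero[of _ _ _ _ "f k" "e j"]) (simp add: T_apply u_Suc v_Suc)
      moreover have "{i, j} \<in> Gamma_B_edges n"
        unfolding edge using path p by simp
      ultimately show ?thesis by blast
    next
      case branch
      have "commutator (?T i) (?T j) \<noteq> 0"
        using branch p two
        by (intro commutator_T_nonzero[of _ _ _ _ "e k" g])
          (simp add: T_apply u_Suc v_Suc u_n'[unfolded branch(3)] v_n'[unfolded branch(3)])
      moreover have "{i, j} \<in> Gamma_B_edges n"
        unfolding edge using branch p by simp
      ultimately show ?thesis by blast
    next
      case last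
      \<comment> \<open>The supports overlap here, but \<open>u n\<close> lies in the span of
        \<open>u i\<close> and \<open>v i\<close>, and \<open>?T n\<close> maps that plane into the
        line of \<open>u n\<close>. The bracket collapses to \<open>T (u n) (u n)\<close>.\<close>
      have 1: "T (u j) (v j) (u i) = u j" and 2: "T (u j) (v j) (v i) = - scale \<gamma> (u j)"
        and 3: "u j = v i + scale \<gamma> (u i)"
        using last p by (simp_all add: T_apply u_Suc v_Suc u_n' v_n' fd.scale_right_distrib)
      have "commutator (?T j) (?T i) = T (u j) (v i) + T (u i) (- scale \<gamma> (u j))"
        by (simp only: commutator_T_T 1 2)
      also have "\<dots> = T (u j) (v i + scale \<gamma> (u i))"
        by (simp add: T_linear T_swap[of "u j" "u i"])
      also have "\<dots> = 0"
        by (simp only: 3[symmetric] T_self)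
      finally have "commutator (?T j) (?T i) = 0" .
      then have "commutator (?T i) (?T j) = 0"
        by (subst commutator_T_swap) simp
      moreover have "{i, j} \<notin> Gamma_B_edges n"
        unfolding edge using last p by simp
      ultimately show ?thesis by blast
    next
      case far1
      \<comment> \<open>In this and the remaining cases the two generators involve disjoint sets of
        basis indices, so their vectors are orthogonal.\<close>
      have "commutator (?T i) (?T j) = 0"
        using far1 p by (intro commutator_T_zero) (simp_all add: u_1 v_1 u_Suc v_Suc)
      moreover have "{i, j} \<notin> Gamma_B_edges n"
        unfolding edge using far1 p by simp
      ultimately show ?thesis by blast
    next
      case far
      have "commutator (?T i) (?T j) = 0"
        using far p by (intro commutator_T_zero) (simp_all add: u_Suc v_Suc)
      moreover have "{i, j} \<notin> Gamma_B_edges n"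
        unfolding edge using far p by simp
      ultimately show ?thesis by blast
    next
      case far1n
      have "commutator (?T i) (?T j) = 0"
        using far1n p by (intro commutator_T_zero) (simp_all add: u_1 v_1 u_n' v_n')
      moreover have "{i, j} \<notin> Gamma_B_edges n"
        unfolding edge using far1n p by simp
      ultimately show ?thesis by blast
    next
      case farn
      have "commutator (?T i) (?T j) = 0"
        using farn p by (intro commutator_T_zero) (simp_all add: u_Suc v_Suc u_n' v_n')
      moreover have "{i, j} \<notin> Gamma_B_edges n"
        unfolding edge using farn p by simp
      ultimately show ?thesis by blast
    qed
  qed
  have "{i, j} \<in> Gamma_B_edges n \<longleftrightarrow> commutator (?T i) (?T j) \<noteq> 0"
    if "i \<in> {1..n}" "j \<in> {1..n}" "i \<noteq> j" for i j
  proof (cases "i < j")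
    case False
    then show ?thesis
      using adjacent[of j i] that commutator_T_swap[of "u i" "v i"] by (simp add: insert_commute)
  qed (use adjacent that in simp)

  \<comment> \<open>Generation of the whole orthogonal Lie algebra\<close>
  moreover have L: "?L = skew_endomorphisms scale B"
  proof
    show "?L \<subseteq> skew_endomorphisms scale B"
      unfolding lie_generated_def
      by (rule hull_minimal) (use T_skew lie_subalgebra_skew in auto)
    show "skew_endomorphisms scale B \<subseteq> ?L"
      unfolding lie_generated_def hull_def
    proof (rule Inter_greatest)
      fix M
      assume "M \<in> {M. lie_subalgebra (fun_scale scale) commutator (endomorphisms scale) M \<and>
        ?T ` {1..n} \<subseteq> M}"
      then have M: "lie_subalgebra (fun_scale scale) commutator (endomorphisms scale) M"
        and TM: "\<And>i. 1 \<le> i \<Longrightarrow> i \<le> n \<Longrightarrow> ?T i \<in> M"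
        by auto
      \<comment> \<open>\<open>M\<close> is an arbitrary member of the family whose intersection is
        the generated algebra.\<close>
      interpret T_subalgebra scale B e f g "{1..<n}" M
        by unfold_locales (rule M)
      have sl: "T (e a) (f b) \<in> M" if "a \<in> {1..<n}" "b \<in> {1..<n}" "a \<noteq> b" for a b
      proof (rule sl_mem[OF refl _ _ _ that])
        show "T (e 1 - e 2) (f 1 + f 2) \<in> M"
          using TM[of 1] n by (simp add: u_1 v_1)
        show "T (e (i - 1) + e i) (f (i - 1) - f i) \<in> M" if "1 < i" "i < n" for i
          using TM[of i] that by (simp add: u_i v_i)
      qed (use n in simp)
      \<comment> \<open>The four indices 1, 2, \<open>n - 2\<close>, \<open>n - 1\<close> are
        distinct because \<open>n \<ge> 5\<close>.\<close>
      have "T z w \<in> M" for z w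
        by (rule T_mem[OF sl, of 1 2 "n - 2" "n - 1" \<gamma>]) (use n TM[of n] \<gamma> u_n v_n in auto)
      then show "skew_endomorphisms scale B \<subseteq> M"
        by (rule skew_subset)
    qed
  qed
  moreover have "extremal (fun_scale scale) commutator ?L (?T i)" if "i \<in> {1..n}" for i
    unfolding L using iso[OF that] nonzero[OF that] two T_skew by (intro extremal_T) auto
  ultimately show ?thesis
    unfolding realizes_graph_def by blast
qed

end
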